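(* Let $\mathcal{S}_D=\{s_\delta,\delta\in\mathcal{D}\}\subset\mathbb{L}_1^+(\lambda)$ be a family of intensities indexed by $\mathcal{D}=\{0;1\}^D$ and let $\Delta$ be the Hamming distance on $\mathcal{D}$ given by $\Delta(\delta,\delta')=\sum_{j=1}^D|\delta_j-\delta_j'|$. Let $\mathcal{C}$ be the subset of $\mathcal{D}\times\mathcal{D}$ defined by $$\mathcal{C}=\{(\delta,\delta') : \exists k,\ 1\le k\le D,\ \text{with } \delta_k=0,\ \delta_k'=1\ \text{ and }\ \delta_j=\delta_j'\text{ for } j\ne k\}.$$ Then for any estimator $\hat\delta(\boldsymbol{X})$ with values in $\mathcal{D}$, $$\sup_{\delta\in\mathcal{D}}\mathbb{E}_{s_\delta}\left[\Delta\left(\hat\delta(\boldsymbol{X}),\delta\right)\right]\ge\frac D4\left(\frac1{|\mathcal{C}|}\sum_{(\delta,\delta')\in\mathcal{C}}\exp\left[-2H^2(s_\delta,s_{\delta'})\right]\right).$$ If, moreover, $\mathcal{S}_D\subset\mathbb{L}\subset\mathbb{L}_1^+(\lambda)$ and $\mathbb{L}$ is endowed with a metric $d$ satisfying $d^2(s_\delta,s_{\delta'})\ge\theta\Delta(\delta,\delta')$ for all $\delta,\delta'\in\mathcal{D}$ and some $\theta>0$, then for any estimator $\hat s(\boldsymbol{X})$ with values in $\mathbb{L}$, $$\sup_{s\in\mathcal{S}_D}\mathbb{E}_s\left[d^2\left(\hat s(\boldsymbol{X}),s\right)\right]\ge\frac{D\theta}{16}\left(\frac1{|\mathcal{C}|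}\sum_{(\delta,\delta')\in\mathcal{C}}\exp\left[-2H^2(s_\delta,s_{\delta'})\right]\right).$$
   Context: $\lambda$ is a positive measure on a measurable space $\mathcal{X}$, $\mathbb{L}_1^+(\lambda)$ the set of nonnegative elements of $\mathbb{L}_1(\lambda)$, and $D$ is a positive integer. A Poisson process with intensity $s\in\mathbb{L}_1^+(\lambda)$ is a point process $\boldsymbol{X}=\{X_1,\dots,X_N\}$ on $\mathcal{X}$ with $N$ Poisson with parameter $\int s\,d\lambda$ and, conditionally on $N$, the $X_i$ i.i.d. with density $s/\int s\,d\lambda$ with respect to $\lambda$; $\mathbb{E}_s$ is the expectation when $\boldsymbol{X}$ has intensity $s$. Estimators are measurable functions of $\boldsymbol{X}$. $H(t,u)=2^{-1/2}\|\sqrt t-\sqrt u\|_2$ for $t,u\in\mathbb{L}_1^+(\lambda)$, with $\|\cdot\|_2$ the $\mathbb{L}_2(\lambda)$-norm. *)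

theory Defs
  imports "HOL-Probability.Probability"
begin

text \<open>
  Elements of \<open>L\<^sub>1\<close> are represented by functions, and equality of classes by equality almost
  everywhere. No \<open>\<sigma>\<close>-finiteness is imposed on the base measure.
\<close>

definition L1_nonneg :: "'a measure \<Rightarrow> ('a \<Rightarrow> real) set" where
  "L1_nonneg M = {f. integrable M f \<and> (AE x in M. 0 \<le> f x)}"

definition L2_norm :: "'a measure \<Rightarrow> ('a \<Rightarrow> real) \<Rightarrow> real" where
  "L2_norm M f = sqrt (LINT x|M. (f x)\<^sup>2)"

definition hellinger :: "'a measure \<Rightarrow> ('a \<Rightarrow> real) \<Rightarrow> ('a \<Rightarrow> real) \<Rightarrow> real" where
  "hellinger M t u = 2 powr (- 1 / 2) * L2_norm M (\<lambda>x. sqrt (t x) - sqrt (u x))"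

text \<open>
  A realization \<open>{X\<^sub>1, \<dots>, X\<^sub>N}\<close> of a finite point process is a finite multiset, since points may
  coincide when the base measure has atoms. The \<open>\<sigma>\<close>-algebra is the one generated by the
  counting maps \<open>X \<mapsto> |X \<inter> A|\<close> for measurable \<open>A\<close>.
\<close>

definition configs :: "'a measure \<Rightarrow> 'a multiset measure" where
  "configs M = sigma {X. set_mset X \<subseteq> space M}
     {{X. set_mset X \<subseteq> space M \<and> size {#x \<in># X. x \<in> A#} = k} | A k. A \<in> sets M}"

text \<open>The library distribution requires a positive rate.\<close>

definition poisson_nat :: "real \<Rightarrow> nat pmf" where
  "poisson_nat m = (if m > 0 then poisson_pmf m else return_pmf 0)"

text \<open>
  The law of \<open>n\<close> independent points with density \<open>s / \<integral>s\<close>, forgetting their order. If \<open>\<integral>s = 0\<close>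
  only \<open>n = 0\<close> matters, and the value is the point mass at the empty configuration.
\<close>

definition iid_points :: "'a measure \<Rightarrow> ('a \<Rightarrow> real) \<Rightarrow> nat \<Rightarrow> 'a multiset measure" where
  "iid_points M s n =
     distr (\<Pi>\<^sub>M i\<in>{1..n}. density M (\<lambda>x. ennreal (s x / (LINT y|M. s y)))) (configs M)
       (\<lambda>x. {#x i. i \<in># mset_set {1..n}#})"

definition poisson_process :: "'a measure \<Rightarrow> ('a \<Rightarrow> real) \<Rightarrow> 'a multiset measure" where
  "poisson_process M s = measure_pmf (poisson_nat (LINT x|M. s x)) \<bind> iid_points M s"

definition cube :: "nat \<Rightarrow> (nat \<Rightarrow> int) set" where
  "cube D = {1..D} \<rightarrow>\<^sub>E {0, 1}"

definition hamming :: "nat \<Rightarrow> (nat \<Rightarrow> int) \<Rightarrow> (nat \<Rightarrow> int) \<Rightarrow> int" where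
  "hamming D \<delta> \<delta>' = (\<Sum>j = 1..D. \<bar>\<delta> j - \<delta>' j\<bar>)"

definition cube_edges :: "nat \<Rightarrow> ((nat \<Rightarrow> int) \<times> (nat \<Rightarrow> int)) set" where
  "cube_edges D = {(\<delta>, \<delta>'). \<delta> \<in> cube D \<and> \<delta>' \<in> cube D \<and>
     (\<exists>k\<in>{1..D}. \<delta> k = 0 \<and> \<delta>' k = 1 \<and> (\<forall>j\<in>{1..D}. j \<noteq> k \<longrightarrow> \<delta> j = \<delta>' j))}"

text \<open>
  A metric on a set of elements of \<open>L\<^sub>1\<close>. On representing functions, points at distance zero are
  those that are equal almost everywhere; by the triangle inequality \<open>d\<close> then depends on the
  classes only.
\<close>

definition L1_metric ::
    "'a measure \<Rightarrow> ('a \<Rightarrow> real) set \<Rightarrow> (('a \<Rightarrow> real) \<Rightarrow> ('a \<Rightarrow> real) \<Rightarrow> real) \<Rightarrow> bool" where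
  "L1_metric M L d \<longleftrightarrow> (\<forall>t\<in>L. \<forall>u\<in>L. 0 \<le> d t u \<and> d t u = d u t \<and>
     (d t u = 0 \<longleftrightarrow> (AE x in M. t x = u x)) \<and> (\<forall>v\<in>L. d t v \<le> d t u + d u v))"

text \<open>
  The \<open>\<sigma>\<close>-algebra generated by the open balls. It makes the maps \<open>u \<mapsto> d t u\<close> measurable and is
  contained in the Borel \<open>\<sigma>\<close>-algebra of the metric, with equality in the separable case, so that
  Borel measurable functions with values in \<open>L\<close> are measurable for it.
\<close>

definition ball_algebra :: "'b set \<Rightarrow> ('b \<Rightarrow> 'b \<Rightarrow> real) \<Rightarrow> 'b measure" where
  "ball_algebra L d = sigma L {{u \<in> L. d t u < r} | t r. t \<in> L}"

text \<open>
  The process is well defined: the passage to multisets is measurable, and the law is a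
  probability measure on configurations.
\<close>

lemma space_configs: "space (configs M) = {X. set_mset X \<subseteq> space M}"
  unfolding configs_def by (rule space_measure_of) auto

lemma measurable_points:
  fixes n :: nat
  assumes [measurable_cong]: "\<And>i. i \<in> {1..n} \<Longrightarrow> sets (K i) = sets M"
  shows "(\<lambda>x. {#x i. i \<in># mset_set {1..n}#}) \<in> Pi\<^sub>M {1..n} K \<rightarrow>\<^sub>M configs M"
  unfolding configs_def
proof (rule measurable_measure_of)
  have sp: "space (K i) = space M" if "i \<in> {1..n}" for i
    using assms[OF that] by (rule sets_eq_imp_space_eq)
  show in_space: "(\<lambda>x. {#x i. i \<in># mset_set {1..n}#}) \<in> space (Pi\<^sub>M {1..n} K) \<rightarrow> {X. set_mset X \<subseteq> space M}"
    using sp by (auto simp: space_PiM PiE_def Pi_def elem_mset_set)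
  fix Y assume "Y \<in> {{X. set_mset X \<subseteq> space M \<and> size {#x \<in># X. x \<in> A#} = k} | A k. A \<in> sets M}"
  then obtain A k where Y: "Y = {X. set_mset X \<subseteq> space M \<and> size {#x \<in># X. x \<in> A#} = k}"
    and A: "A \<in> sets M" by blast
  have cnt: "size (filter_mset (\<lambda>y. y \<in> A) {#x i. i \<in># mset_set {1..n}#}) = (\<Sum>i = 1..n. if x i \<in> A then 1 else 0)"
    for x :: "nat \<Rightarrow> 'a"
    by (simp add: filter_mset_image_mset sum.If_cases Int_def conj_commute)
  have [measurable]: "(\<lambda>x. if x i \<in> A then 1 else 0 :: nat) \<in> Pi\<^sub>M {1..n} K \<rightarrow>\<^sub>M count_space UNIV"
    if i: "i \<in> {1..n}" for i
  proof -
    have "A \<in> sets (K i)" using A assms[OF i] by simp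
    moreover have "(\<lambda>x. x i) \<in> Pi\<^sub>M {1..n} K \<rightarrow>\<^sub>M K i" using i by (rule measurable_component_singleton)
    ultimately show ?thesis by measurable
  qed
  have "(\<lambda>x. \<Sum>i = 1..n. if x i \<in> A then 1 else 0 :: nat) \<in> Pi\<^sub>M {1..n} K \<rightarrow>\<^sub>M count_space UNIV"
    by measurable
  then have "(\<lambda>x. \<Sum>i = 1..n. if x i \<in> A then 1 else 0 :: nat) -` {k} \<inter> space (Pi\<^sub>M {1..n} K)
      \<in> sets (Pi\<^sub>M {1..n} K)"
    by (rule measurable_sets) simp
  moreover have "(\<lambda>x. {#x i. i \<in># mset_set {1..n}#}) -` Y \<inter> space (Pi\<^sub>M {1..n} K)
      = (\<lambda>x. \<Sum>i = 1..n. if x i \<in> A then 1 else 0 :: nat) -` {k} \<inter> space (Pi\<^sub>M {1..n} K)"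
    unfolding Y vimage_def Int_def mem_Collect_eq cnt
    using in_space by (intro Collect_cong) (fast dest: funcset_mem)
  ultimately show "(\<lambda>x. {#x i. i \<in># mset_set {1..n}#}) -` Y \<inter> space (Pi\<^sub>M {1..n} K)
      \<in> sets (Pi\<^sub>M {1..n} K)" by simp
qed auto

lemma sets_iid_points: "sets (iid_points M s n) = sets (configs M)"
  by (simp add: iid_points_def)

lemma emeasure_normalized_density:
  assumes s: "s \<in> L1_nonneg M"
  shows "emeasure (density M (\<lambda>x. ennreal (s x / (LINT y|M. s y)))) (space M)
    = (if (LINT y|M. s y) > 0 then 1 else 0)"
proof -
  let ?m = "LINT y|M. s y"
  have int: "integrable M s" and ae: "AE x in M. 0 \<le> s x" using s by (auto simp: L1_nonneg_def)
  have m: "0 \<le> ?m" using ae by (rule integral_nonneg_AE)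
  have "emeasure (density M (\<lambda>x. ennreal (s x / ?m))) (space M) = (\<integral>\<^sup>+x. ennreal (s x / ?m) \<partial>M)"
    using int by (subst emeasure_density) (auto intro!: nn_integral_cong)
  also have "\<dots> = ennreal (LINT x|M. s x / ?m)"
    using int ae m by (intro nn_integral_eq_integral) (auto elim!: eventually_mono)
  also have "(LINT x|M. s x / ?m) = (if ?m > 0 then 1 else 0)" using m by auto
  finally show ?thesis by (simp split: if_splits)
qed

lemma prob_space_iid_points:
  assumes s: "s \<in> L1_nonneg M" and n: "(LINT x|M. s x) > 0 \<or> n = 0"
  shows "prob_space (iid_points M s n)"
proof -
  let ?K = "density M (\<lambda>x. ennreal (s x / (LINT y|M. s y)))"
  have "prob_space (\<Pi>\<^sub>M i\<in>{1..n}. ?K)"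
  proof (cases "n = 0")
    case True
    then show ?thesis by (auto intro!: prob_spaceI simp: space_PiM PiM_empty)
  next
    case False
    with n have "prob_space ?K"
      by (intro prob_spaceI) (simp add: emeasure_normalized_density[OF s])
    then show ?thesis by (intro prob_space_PiM)
  qed
  then show ?thesis
    unfolding iid_points_def by (rule prob_space.prob_space_distr) (rule measurable_points, simp)
qed

lemma subprob_iid_points:
  assumes s: "s \<in> L1_nonneg M"
  shows "iid_points M s n \<in> space (subprob_algebra (configs M))"
proof (cases "(LINT x|M. s x) > 0 \<or> n = 0")
  case True
  then show ?thesis
    using prob_space_iid_points[OF s True]
    by (simp add: space_subprob_algebra sets_iid_points prob_space_imp_subprob_space)
next
  case False
  let ?K = "density M (\<lambda>x. ennreal (s x / (LINT y|M. s y)))"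
  have K0: "emeasure ?K (space M) = 0" using False by (simp add: emeasure_normalized_density[OF s])
  interpret K: finite_measure ?K by (rule finite_measureI) (simp add: K0)
  interpret P: product_sigma_finite "\<lambda>i::nat. ?K" by unfold_locales
  have map: "(\<lambda>x. {#x i. i \<in># mset_set {1..n}#}) \<in> (\<Pi>\<^sub>M i\<in>{1..n}. ?K) \<rightarrow>\<^sub>M configs M"
    by (rule measurable_points) simp
  have "emeasure (\<Pi>\<^sub>M i\<in>{1..n}. ?K) (space (\<Pi>\<^sub>M i\<in>{1..n}. ?K)) = (\<Prod>i\<in>{1..n}. emeasure ?K (space ?K))"
    unfolding space_PiM by (rule P.emeasure_PiM) auto
  then have 0: "emeasure (\<Pi>\<^sub>M i\<in>{1..n}. ?K) (space (\<Pi>\<^sub>M i\<in>{1..n}. ?K)) = 0"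
    using False K0 by (simp add: power_0_left)
  have "subprob_space (iid_points M s n)"
  proof (rule subprob_spaceI)
    have "(\<lambda>x. {#x i. i \<in># mset_set {1..n}#}) -` space (configs M) \<inter> space (\<Pi>\<^sub>M i\<in>{1..n}. ?K)
        = space (\<Pi>\<^sub>M i\<in>{1..n}. ?K)"
      using measurable_space[OF map] by auto
    then show "emeasure (iid_points M s n) (space (iid_points M s n)) \<le> 1"
      unfolding iid_points_def using 0 map by (simp add: emeasure_distr)
    show "space (iid_points M s n) \<noteq> {}"
      by (auto simp: iid_points_def space_configs intro!: exI[of _ "{#}"])
  qed
  then show ?thesis by (simp add: space_subprob_algebra sets_iid_points)
qed

lemma sets_poisson_process: "sets (poisson_process M s) = sets (configs M)"
  unfolding poisson_process_def by (rule sets_bind) (auto simp: sets_iid_points)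

lemma prob_space_poisson_process:
  assumes s: "s \<in> L1_nonneg M"
  shows "prob_space (poisson_process M s)"
  unfolding poisson_process_def
proof (rule prob_space.prob_space_bind)
  show "prob_space (measure_pmf (poisson_nat (LINT x|M. s x)))"
    by (rule prob_space_measure_pmf)
  show "AE n in measure_pmf (poisson_nat (LINT x|M. s x)). prob_space (iid_points M s n)"
    using prob_space_iid_points[OF s]
    by (auto simp: AE_measure_pmf_iff poisson_nat_def split: if_splits)
  show "iid_points M s \<in> measure_pmf (poisson_nat (LINT x|M. s x)) \<rightarrow>\<^sub>M subprob_algebra (configs M)"
    using subprob_iid_points[OF s] by simp
qed

end

theory Submission
  imports Defs
begin

text \<open>
  This is Assouad's argument. The Hamming loss is a sum of one loss per coordinate, and the
  supremum of the risk over the cube is at least its average. Averaging groups the vertices of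
  the cube, for each coordinate \<open>k\<close>, into the edges in direction \<open>k\<close>. The two vertices of an edge
  contribute the sum of the two error probabilities of the test of \<open>s\<^sub>\<delta>\<close> against \<open>s\<^sub>\<delta>\<^sub>'\<close> that reads
  off the \<open>k\<close>-th coordinate of the estimator (\<open>assouad\<close>, \<open>poisson_assouad\<close>).

  It remains to show that no test between two Poisson processes has total error below
  \<open>\<rho>\<^sup>2 / 2\<close>, where \<open>\<rho> = \<integral>\<surd>(dP dQ) = exp (- H\<^sup>2)\<close> is their affinity (\<open>poisson_testing_error\<close>). For
  probabilities with densities \<open>p\<close> and \<open>q\<close> and any \<open>c > 0\<close>, weighting the arithmetic-geometric mean
  inequality differently on the two decision regions bounds \<open>\<surd>(p q)\<close> by \<open>c/2\<close> times the density
  of the error plus \<open>(p + q) / (2 c)\<close>. Integrating gives \<open>\<rho> \<le> c/2 \<cdot> error + 1/c\<close>, and \<open>c = 2/\<rho>\<close>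
  is the best choice.

  Both processes need densities with respect to one reference. The base measure \<open>\<lambda>\<close> may fail to be
  \<open>\<sigma>\<close>-finite, so that its powers are unavailable; the finite measure \<open>\<mu> = (s + t) \<lambda>\<close>
  replaces it. On configurations of \<open>n\<close> points, a process whose intensity has mass \<open>m\<close> and
  \<open>\<mu>\<close>-density \<open>a\<close> has the density \<open>exp (- m) / n! \<cdot> \<Prod>a(x\<^sub>i)\<close> with respect to \<open>\<mu>\<^sup>n\<close>
  (\<open>nn_integral_poisson_process\<close>). The geometric mean of two such densities is again of product
  form, and the affinity is an exponential series with sum
  \<open>exp (- (m\<^sub>s + m\<^sub>t) / 2 + \<integral>\<surd>(s t))\<close>, which is \<open>exp (- H\<^sup>2)\<close>.

  For the bound on \<open>d\<^sup>2\<close>, an estimator of the intensity yields the estimator of \<open>\<delta>\<close> that picks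
  the nearest \<open>s\<^sub>\<delta>\<close>. By the triangle inequality its distance from the true intensity is at most
  twice that of the original estimator, hence the additional factor \<open>\<theta> / 4\<close>.
\<close>

section \<open>Densities of Poisson processes\<close>

text \<open>
  Products of densities are determined on boxes, where the integral of a product of functions
  of single coordinates factorizes.
\<close>

lemma PiM_density:
  assumes fin: "finite I"
    and N: "product_sigma_finite N"
    and g [measurable]: "\<And>i. g i \<in> borel_measurable (N i)"
    and dens: "product_sigma_finite (\<lambda>i. density (N i) (g i))"
  shows "Pi\<^sub>M I (\<lambda>i. density (N i) (g i)) = density (Pi\<^sub>M I N) (\<lambda>x. \<Prod>i\<in>I. g i (x i))"
proof -
  interpret N: product_sigma_finite N by (rule N)
  interpret G: product_sigma_finite "\<lambda>i. density (N i) (g i)" by (rule dens)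
  have "density (Pi\<^sub>M I N) (\<lambda>x. \<Prod>i\<in>I. g i (x i)) = Pi\<^sub>M I (\<lambda>i. density (N i) (g i))"
  proof (rule G.PiM_eqI[OF fin])
    show "sets (density (Pi\<^sub>M I N) (\<lambda>x. \<Prod>i\<in>I. g i (x i))) = sets (Pi\<^sub>M I (\<lambda>i. density (N i) (g i)))"
      by (simp cong: sets_PiM_cong)
    fix A assume "\<And>i. i \<in> I \<Longrightarrow> A i \<in> sets (density (N i) (g i))"
    then have A [measurable]: "\<And>i. i \<in> I \<Longrightarrow> A i \<in> sets (N i)" by simp
    have "emeasure (density (Pi\<^sub>M I N) (\<lambda>x. \<Prod>i\<in>I. g i (x i))) (Pi\<^sub>E I A)
        = (\<integral>\<^sup>+x. (\<Prod>i\<in>I. g i (x i)) * indicator (Pi\<^sub>E I A) x \<partial>Pi\<^sub>M I N)"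
      using fin by (intro emeasure_density) (auto intro!: sets_PiM_I_finite A)
    also have "\<dots> = (\<integral>\<^sup>+x. (\<Prod>i\<in>I. g i (x i) * indicator (A i) (x i)) \<partial>Pi\<^sub>M I N)"
    proof (intro nn_integral_cong)
      fix x assume "x \<in> space (Pi\<^sub>M I N)"
      then have "indicator (Pi\<^sub>E I A) x = (\<Prod>i\<in>I. indicator (A i) (x i) :: ennreal)"
        using fin by (auto simp: indicator_def space_PiM PiE_iff intro!: prod.neutral)
      then show "(\<Prod>i\<in>I. g i (x i)) * indicator (Pi\<^sub>E I A) x
          = (\<Prod>i\<in>I. g i (x i) * indicator (A i) (x i))"
        by (simp add: prod.distrib)
    qed
    also have "\<dots> = (\<Prod>i\<in>I. \<integral>\<^sup>+y. g i y * indicator (A i) y \<partial>N i)"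
      using fin by (intro N.product_nn_integral_prod) auto
    also have "\<dots> = (\<Prod>i\<in>I. emeasure (density (N i) (g i)) (A i))"
      by (intro prod.cong refl) (simp add: emeasure_density)
    finally show "emeasure (density (Pi\<^sub>M I N) (\<lambda>x. \<Prod>i\<in>I. g i (x i))) (Pi\<^sub>E I A)
        = (\<Prod>i\<in>I. emeasure (density (N i) (g i)) (A i))" .
  qed
  then show ?thesis ..
qed

abbreviation points :: "nat \<Rightarrow> (nat \<Rightarrow> 'a) \<Rightarrow> 'a multiset" where
  "points n x \<equiv> {#x i. i \<in># mset_set {1..n}#}"

text \<open>
  The density, on ordered \<open>n\<close>-tuples, of the process whose intensity has density \<open>a\<close> and mass \<open>m\<close>:
  the Janossy density divided by \<open>n!\<close>.
\<close>

definition janossy :: "real \<Rightarrow> ('a \<Rightarrow> real) \<Rightarrow> nat \<Rightarrow> (nat \<Rightarrow> 'a) \<Rightarrow> real" where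
  "janossy m a n x = exp (- m) / fact n * (\<Prod>i = 1..n. a (x i))"

lemma janossy_nonneg: "(\<And>x. 0 \<le> a x) \<Longrightarrow> 0 \<le> janossy m a n x"
  by (simp add: janossy_def prod_nonneg)

lemma measurable_janossy [measurable]:
  assumes [measurable]: "a \<in> borel_measurable \<mu>"
  shows "janossy m a n \<in> borel_measurable (\<Pi>\<^sub>M i\<in>{1..n}. \<mu>)"
  unfolding janossy_def by measurable

lemma pmf_poisson_nat:
  assumes "0 \<le> m"
  shows "pmf (poisson_nat m) n = m ^ n / fact n * exp (- m)"
  using assms by (cases "m = 0") (auto simp: poisson_nat_def pmf_return power_0_left indicator_def)

text \<open>
  The Poisson weight \<open>exp (- m) m\<^sup>n / n!\<close> cancels the \<open>n\<close> normalizing factors \<open>1 / m\<close> of the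
  independent points. What remains makes sense for \<open>m = 0\<close> as well, which is why it is the
  convenient representation. The reference measure may be any finite one, so that two processes
  can be compared under a common one.
\<close>

lemma nn_integral_poisson_process:
  assumes s: "s \<in> L1_nonneg M"
    and fin: "finite_measure \<mu>" and sets_\<mu> [measurable_cong]: "sets \<mu> = sets M"
    and a [measurable]: "a \<in> borel_measurable \<mu>" and a_nonneg: "\<And>x. 0 \<le> a x"
    and dens: "density M (\<lambda>x. ennreal (s x)) = density \<mu> (\<lambda>x. ennreal (a x))"
    and f [measurable]: "f \<in> borel_measurable (configs M)"
  shows "(\<integral>\<^sup>+X. f X \<partial>poisson_process M s)
    = (\<Sum>n. \<integral>\<^sup>+x. ennreal (janossy (LINT y|M. s y) a n x) * f (points n x) \<partial>(\<Pi>\<^sub>M i\<in>{1..n}. \<mu>))"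
proof -
  define m where "m = (LINT y|M. s y)"
  have int: "integrable M s" and ae: "AE x in M. 0 \<le> s x" using s by (auto simp: L1_nonneg_def)
  have [measurable]: "s \<in> borel_measurable M" using int by auto
  have m: "0 \<le> m" unfolding m_def using ae by (rule integral_nonneg_AE)
  interpret \<mu>: finite_measure \<mu> by (rule fin)
  interpret P: product_sigma_finite "\<lambda>i::nat. \<mu>" by unfold_locales
  have mass: "(\<integral>\<^sup>+x. ennreal (a x) \<partial>\<mu>) = ennreal m"
  proof -
    have "(\<integral>\<^sup>+x. ennreal (a x) \<partial>\<mu>) = emeasure (density \<mu> (\<lambda>x. ennreal (a x))) (space M)"
      using sets_eq_imp_space_eq[OF sets_\<mu>]
      by (subst emeasure_density) (auto intro!: nn_integral_cong)
    also have "\<dots> = (\<integral>\<^sup>+x. ennreal (s x) \<partial>M)"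
      unfolding dens[symmetric] by (subst emeasure_density) (auto intro!: nn_integral_cong)
    finally show ?thesis unfolding m_def using int ae by (simp add: nn_integral_eq_integral)
  qed
  \<comment> \<open>Division by zero gives zero, so that this holds for \<open>m = 0\<close> too.\<close>
  have normalized: "density M (\<lambda>x. ennreal (s x / m)) = density \<mu> (\<lambda>x. ennreal (a x / m))"
  proof -
    have "density M (\<lambda>x. ennreal (s x / m))
        = density (density M (\<lambda>x. ennreal (s x))) (\<lambda>x. ennreal (1 / m))"
      using m by (simp add: density_density_eq ennreal_mult'' [symmetric])
    also have "\<dots> = density \<mu> (\<lambda>x. ennreal (a x / m))"
      unfolding dens using m by (simp add: density_density_eq ennreal_mult'' [symmetric])
    finally show ?thesis .
  qed
  have fin_norm: "finite_measure (density \<mu> (\<lambda>x. ennreal (a x / m)))"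
    by (rule finite_measureI)
      (use emeasure_normalized_density[OF s] sets_eq_imp_space_eq[OF sets_\<mu>] in
        \<open>simp flip: normalized m_def split: if_splits\<close>)
  then have psf_norm: "product_sigma_finite (\<lambda>i::nat. density \<mu> (\<lambda>x. ennreal (a x / m)))"
    by (intro product_sigma_finite.intro) (auto dest: finite_measure.axioms)
  have pts [measurable]: "points n \<in> (\<Pi>\<^sub>M i\<in>{1..n}. \<mu>) \<rightarrow>\<^sub>M configs M" for n
    by (rule measurable_points) (rule sets_\<mu>)
  have iid: "(\<integral>\<^sup>+X. f X \<partial>iid_points M s n)
      = (\<integral>\<^sup>+x. ennreal (\<Prod>i = 1..n. a (x i) / m) * f (points n x) \<partial>(\<Pi>\<^sub>M i\<in>{1..n}. \<mu>))" for n
  proof -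
    have "(\<integral>\<^sup>+X. f X \<partial>iid_points M s n)
        = (\<integral>\<^sup>+x. f (points n x) \<partial>(\<Pi>\<^sub>M i\<in>{1..n}. density M (\<lambda>x. ennreal (s x / m))))"
      unfolding iid_points_def m_def by (rule nn_integral_distr, rule measurable_points, simp, simp add: f)
    also have "(\<Pi>\<^sub>M i\<in>{1..n}. density M (\<lambda>x. ennreal (s x / m)))
        = density (\<Pi>\<^sub>M i\<in>{1..n}. \<mu>) (\<lambda>x. \<Prod>i = 1..n. ennreal (a (x i) / m))"
      unfolding normalized
      by (rule PiM_density[OF _ _ _ psf_norm]) (auto intro: P.product_sigma_finite_axioms)
    also have "(\<lambda>x. \<Prod>i = 1..n. ennreal (a (x i) / m)) = (\<lambda>x. ennreal (\<Prod>i = 1..n. a (x i) / m))"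
      using a_nonneg m by (intro ext prod_ennreal) auto
    finally show ?thesis by (simp add: nn_integral_density del: One_nat_def)
  qed
  have summand: "ennreal (pmf (poisson_nat m) n) * (\<integral>\<^sup>+X. f X \<partial>iid_points M s n)
      = (\<integral>\<^sup>+x. ennreal (janossy m a n x) * f (points n x) \<partial>(\<Pi>\<^sub>M i\<in>{1..n}. \<mu>))" for n
  \<comment> \<open>If \<open>m = 0\<close> and \<open>n > 0\<close> nothing cancels, but both sides vanish.\<close>
  proof (cases "m = 0 \<and> n > 0")
    case False
    have "janossy m a n x = pmf (poisson_nat m) n * (\<Prod>i = 1..n. a (x i) / m)" for x
      using False by (cases "n = 0") (auto simp: pmf_poisson_nat[OF m] janossy_def prod_dividef)
    then have "ennreal (pmf (poisson_nat m) n) * (ennreal (\<Prod>i = 1..n. a (x i) / m) * c)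
        = ennreal (janossy m a n x) * c" for x c
      using m a_nonneg by (simp add: ennreal_mult prod_nonneg mult.assoc)
    then show ?thesis
      unfolding iid by (subst nn_integral_cmult[symmetric]) (auto simp del: One_nat_def)
  next
    case True
    have "(\<integral>\<^sup>+x. ennreal (\<Prod>i = 1..n. a (x i)) \<partial>(\<Pi>\<^sub>M i\<in>{1..n}. \<mu>))
        = (\<Prod>i = 1..n. \<integral>\<^sup>+x. ennreal (a x) \<partial>\<mu>)"
      using a_nonneg P.product_nn_integral_prod[of "{1..n}" "\<lambda>_ x. ennreal (a x)"]
      by (simp add: prod_ennreal)
    also have "\<dots> = 0" using True by (simp add: mass power_0_left)
    finally have "AE x in (\<Pi>\<^sub>M i\<in>{1..n}. \<mu>). ennreal (\<Prod>i = 1..n. a (x i)) = 0"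
      by (subst (asm) nn_integral_0_iff_AE) auto
    then have "AE x in (\<Pi>\<^sub>M i\<in>{1..n}. \<mu>). ennreal (janossy m a n x) * f (points n x) = 0"
    proof eventually_elim
      case (elim x)
      then have "(\<Prod>i = 1..n. a (x i)) = 0"
        using prod_nonneg[of "{1..n}" "\<lambda>i. a (x i)"] a_nonneg by (metis antisym ennreal_eq_0_iff)
      then have "janossy m a n x = 0" by (auto simp: janossy_def)
      then show ?case by simp
    qed
    then have "(\<integral>\<^sup>+x. ennreal (janossy m a n x) * f (points n x) \<partial>(\<Pi>\<^sub>M i\<in>{1..n}. \<mu>)) = 0"
      by (subst nn_integral_0_iff_AE) (auto simp del: One_nat_def)
    then show ?thesis using True by (simp add: pmf_poisson_nat)
  qed
  have "(\<integral>\<^sup>+X. f X \<partial>poisson_process M s)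
      = (\<integral>\<^sup>+n. \<integral>\<^sup>+X. f X \<partial>iid_points M s n \<partial>measure_pmf (poisson_nat m))"
    unfolding poisson_process_def m_def
    by (rule nn_integral_bind[OF f]) (use subprob_iid_points[OF s] in simp)
  also have "\<dots> = (\<Sum>n. ennreal (pmf (poisson_nat m) n) * (\<integral>\<^sup>+X. f X \<partial>iid_points M s n))"
    by (simp add: nn_integral_measure_pmf nn_integral_count_space_nat)
  finally show ?thesis unfolding summand unfolding m_def .
qed

section \<open>Testing between two Poisson processes\<close>

text \<open>
  Expand the square. The positive parts change the integrand on a null set only and avoid the
  values of \<open>sqrt\<close> at negative numbers.
\<close>

lemma hellinger_sq:
  assumes s: "s \<in> L1_nonneg M" and t: "t \<in> L1_nonneg M"
  shows "integrable M (\<lambda>x. sqrt (max 0 (s x) * max 0 (t x)))"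
    and "(hellinger M s t)\<^sup>2
      = ((LINT x|M. s x) + (LINT x|M. t x)) / 2 - (LINT x|M. sqrt (max 0 (s x) * max 0 (t x)))"
proof -
  have s_int [simp]: "integrable M s" and s_nn: "AE x in M. 0 \<le> s x"
    using s by (auto simp: L1_nonneg_def)
  have t_int [simp]: "integrable M t" and t_nn: "AE x in M. 0 \<le> t x"
    using t by (auto simp: L1_nonneg_def)
  have [measurable]: "s \<in> borel_measurable M" "t \<in> borel_measurable M"
    using borel_measurable_integrable[OF s_int] borel_measurable_integrable[OF t_int] by this+
  show r_int [simp]: "integrable M (\<lambda>x. sqrt (max 0 (s x) * max 0 (t x)))"
  proof (rule Bochner_Integration.integrable_bound)
    show "integrable M (\<lambda>x. \<bar>s x\<bar> + \<bar>t x\<bar>)" by simp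
    have "sqrt (max 0 (s x) * max 0 (t x)) \<le> \<bar>s x\<bar> + \<bar>t x\<bar>" for x
      using arith_geo_mean_sqrt[of "max 0 (s x)" "max 0 (t x)"] by simp
    then show "AE x in M. norm (sqrt (max 0 (s x) * max 0 (t x))) \<le> norm (\<bar>s x\<bar> + \<bar>t x\<bar>)"
      by simp
  qed measurable
  have "(hellinger M s t)\<^sup>2 = (LINT x|M. (sqrt (s x) - sqrt (t x))\<^sup>2) / 2"
    by (simp add: hellinger_def L2_norm_def power_mult_distrib powr_half_sqrt_powr real_sqrt_pow2
        powr_minus powr_half_sqrt power_inverse)
  also have "(LINT x|M. (sqrt (s x) - sqrt (t x))\<^sup>2)
      = (LINT x|M. s x + t x - 2 * sqrt (max 0 (s x) * max 0 (t x)))"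
    using s_nn t_nn
    by (intro integral_cong_AE) (auto elim!: eventually_elim2 simp: power2_diff real_sqrt_mult)
  also have "\<dots> / 2 = ((LINT x|M. s x) + (LINT x|M. t x)) / 2
      - (LINT x|M. sqrt (max 0 (s x) * max 0 (t x)))"
    by simp
  finally show "(hellinger M s t)\<^sup>2
      = ((LINT x|M. s x) + (LINT x|M. t x)) / 2 - (LINT x|M. sqrt (max 0 (s x) * max 0 (t x)))" .
qed

text \<open>
  Here \<open>A\<close> says that the test decides against the first hypothesis, so that the factor of \<open>c / 2\<close>
  is the density of the error. The bound follows from \<open>2 \<surd>(p q) \<le> c p + q / c\<close> if \<open>A\<close> holds and
  \<open>2 \<surd>(p q) \<le> c q + p / c\<close> otherwise.
\<close>

lemma sqrt_mult_le_testing: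
  fixes p q c :: real
  assumes "0 \<le> p" "0 \<le> q" "0 < c"
  shows "sqrt (p * q) \<le> c / 2 * (p * of_bool A + q * of_bool (\<not> A)) + 1 / (2 * c) * (p + q)"
proof -
  have *: "sqrt (x * y) \<le> c / 2 * x + 1 / (2 * c) * (x + y)" if "0 \<le> x" "0 \<le> y" for x y :: real
  proof -
    have "sqrt (x * y) = sqrt (c * x * (y / c))" using assms by simp
    also have "\<dots> \<le> (c * x + y / c) / 2"
      using that assms by (intro arith_geo_mean_sqrt) auto
    also have "\<dots> \<le> c / 2 * x + 1 / (2 * c) * (x + y)"
      using that assms by (simp add: field_simps)
    finally show ?thesis .
  qed
  show ?thesis
    using *[of p q] *[of q p] assms by (cases A) (auto simp: mult.commute add.commute)
qed

text \<open>
  The set \<open>E\<close> is where the test rejects \<open>s\<close>. The squared affinity of the two processes is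
  \<open>exp (- 2 H\<^sup>2)\<close>.
\<close>

lemma poisson_testing_error:
  assumes s: "s \<in> L1_nonneg M" and t: "t \<in> L1_nonneg M" and E [measurable]: "E \<in> sets (configs M)"
  shows "ennreal (exp (- 2 * (hellinger M s t)\<^sup>2) / 2)
    \<le> emeasure (poisson_process M s) E + emeasure (poisson_process M t) (space (configs M) - E)"
proof -
  define ms where "ms = (LINT x|M. s x)"
  define mt where "mt = (LINT x|M. t x)"
  define r where "r = (LINT x|M. sqrt (max 0 (s x) * max 0 (t x)))"
  have s_int: "integrable M s" and t_int: "integrable M t"
    using s t by (auto simp: L1_nonneg_def)
  then have [measurable]: "s \<in> borel_measurable M" "t \<in> borel_measurable M" by auto
  have r: "0 \<le> r" by (simp add: r_def)

  \<comment> \<open>Taking positive parts makes the densities nonnegative everywhere, not only almost everywhere.\<close>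
  define u where "u x = max 0 (s x) + max 0 (t x)" for x
  define a where "a x = max 0 (s x) / u x" for x
  define b where "b x = max 0 (t x) / u x" for x
  define \<mu> where "\<mu> = density M (\<lambda>x. ennreal (u x))"
  have u_nonneg: "0 \<le> u x" and a_nonneg: "0 \<le> a x" and b_nonneg: "0 \<le> b x" for x
    by (auto simp: u_def a_def b_def)
  have u_a: "u x * a x = max 0 (s x)" and u_b: "u x * b x = max 0 (t x)" for x
    by (auto simp: u_def a_def b_def)
  have [measurable]: "u \<in> borel_measurable M" "a \<in> borel_measurable M" "b \<in> borel_measurable M"
    unfolding u_def a_def b_def by measurable
  have [measurable_cong]: "sets \<mu> = sets M" by (simp add: \<mu>_def)
  have dens_s: "density M (\<lambda>x. ennreal (s x)) = density \<mu> (\<lambda>x. ennreal (a x))"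
    unfolding \<mu>_def
    by (subst density_density_eq)
      (auto simp: u_nonneg u_a max_def ennreal_neg simp flip: ennreal_mult'' ennreal_mult'
        intro!: density_cong)
  have dens_t: "density M (\<lambda>x. ennreal (t x)) = density \<mu> (\<lambda>x. ennreal (b x))"
    unfolding \<mu>_def
    by (subst density_density_eq)
      (auto simp: u_nonneg u_b max_def ennreal_neg simp flip: ennreal_mult'' ennreal_mult'
        intro!: density_cong)
  have fin: "finite_measure \<mu>"
  proof (rule finite_measureI)
    have "integrable M u" unfolding u_def using s_int t_int by auto
    then have "(\<integral>\<^sup>+x. ennreal (u x) \<partial>M) \<noteq> \<infinity>"
      using u_nonneg by (simp add: nn_integral_eq_integral)
    then show "emeasure \<mu> (space \<mu>) \<noteq> \<infinity>"
      by (simp add: \<mu>_def emeasure_density cong: nn_integral_cong)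
  qed
  interpret \<mu>: finite_measure \<mu> by (rule fin)
  interpret P: product_sigma_finite "\<lambda>i::nat. \<mu>" by unfold_locales
  have aff1: "(\<integral>\<^sup>+x. ennreal (sqrt (a x * b x)) \<partial>\<mu>) = ennreal r"
  proof -
    have "u x * sqrt (a x * b x) = sqrt (max 0 (s x) * max 0 (t x))" for x
    proof -
      have "u x * sqrt (a x * b x) = sqrt ((u x * a x) * (u x * b x))"
        using u_nonneg[of x] by (simp add: real_sqrt_mult)
      then show ?thesis by (simp only: u_a u_b)
    qed
    then have "(\<integral>\<^sup>+x. ennreal (sqrt (a x * b x)) \<partial>\<mu>)
        = (\<integral>\<^sup>+x. ennreal (sqrt (max 0 (s x) * max 0 (t x))) \<partial>M)"
      unfolding \<mu>_def using u_nonneg by (simp add: nn_integral_density flip: ennreal_mult')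
    also have "\<dots> = ennreal r"
      unfolding r_def using hellinger_sq(1)[OF s t] by (intro nn_integral_eq_integral) auto
    finally show ?thesis .
  qed

  define p where "p = janossy ms a"
  define q where "q = janossy mt b"
  have [measurable]: "p n \<in> borel_measurable (\<Pi>\<^sub>M i\<in>{1..n}. \<mu>)"
    "q n \<in> borel_measurable (\<Pi>\<^sub>M i\<in>{1..n}. \<mu>)" for n
    unfolding p_def q_def by (rule measurable_janossy, simp add: \<mu>_def)+
  have p_nonneg: "0 \<le> p n x" and q_nonneg: "0 \<le> q n x" for n x
    unfolding p_def q_def using a_nonneg b_nonneg by (auto intro: janossy_nonneg)
  have repr_s: "(\<integral>\<^sup>+X. f X \<partial>poisson_process M s)
      = (\<Sum>n. \<integral>\<^sup>+x. ennreal (p n x) * f (points n x) \<partial>(\<Pi>\<^sub>M i\<in>{1..n}. \<mu>))"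
    if "f \<in> borel_measurable (configs M)" for f
    unfolding p_def ms_def
    by (rule nn_integral_poisson_process[OF s fin _ _ a_nonneg dens_s that])
      (simp_all add: \<mu>_def)
  have repr_t: "(\<integral>\<^sup>+X. f X \<partial>poisson_process M t)
      = (\<Sum>n. \<integral>\<^sup>+x. ennreal (q n x) * f (points n x) \<partial>(\<Pi>\<^sub>M i\<in>{1..n}. \<mu>))"
    if "f \<in> borel_measurable (configs M)" for f
    unfolding q_def mt_def
    by (rule nn_integral_poisson_process[OF t fin _ _ b_nonneg dens_t that])
      (simp_all add: \<mu>_def)
  have pts [measurable]: "points n \<in> (\<Pi>\<^sub>M i\<in>{1..n}. \<mu>) \<rightarrow>\<^sub>M configs M" for n
    by (rule measurable_points) (simp add: \<mu>_def)

  define \<rho> where "\<rho> = exp (- (hellinger M s t)\<^sup>2)"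
  have \<rho>: "0 < \<rho>" by (simp add: \<rho>_def)
  \<comment> \<open>The exponential series for \<open>r = \<integral>\<surd>(s t)\<close> appears, multiplied by \<open>exp (- (m\<^sub>s + m\<^sub>t) / 2)\<close>.\<close>
  have affinity: "(\<Sum>n. \<integral>\<^sup>+x. ennreal (sqrt (p n x * q n x)) \<partial>(\<Pi>\<^sub>M i\<in>{1..n}. \<mu>)) = ennreal \<rho>"
  proof -
    define C where "C = exp (- (ms + mt) / 2)"
    have C: "0 \<le> C" by (simp add: C_def)
    have "sqrt (p n x * q n x) = C / fact n * (\<Prod>i = 1..n. sqrt (a (x i) * b (x i)))" for n x
    proof -
      have "(\<Prod>i = 1..n. sqrt (a (x i) * b (x i)))\<^sup>2 = (\<Prod>i = 1..n. a (x i) * b (x i))"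
        using a_nonneg b_nonneg by (simp add: prod_power_distrib)
      moreover have "C\<^sup>2 = exp (- ms) * exp (- mt)"
        by (simp add: C_def power2_eq_square flip: exp_add)
      ultimately have "(C / fact n * (\<Prod>i = 1..n. sqrt (a (x i) * b (x i))))\<^sup>2 = p n x * q n x"
        by (simp add: p_def q_def janossy_def power_mult_distrib power_divide prod.distrib)
          (simp add: power2_eq_square)
      then show ?thesis
        using a_nonneg b_nonneg by (intro real_sqrt_unique) (simp_all add: C prod_nonneg)
    qed
    then have "ennreal (sqrt (p n x * q n x))
        = ennreal (C / fact n) * (\<Prod>i = 1..n. ennreal (sqrt (a (x i) * b (x i))))" for n x
      using a_nonneg b_nonneg C by (simp add: prod_ennreal prod_nonneg flip: ennreal_mult)
    then have "(\<integral>\<^sup>+x. ennreal (sqrt (p n x * q n x)) \<partial>(\<Pi>\<^sub>M i\<in>{1..n}. \<mu>))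
        = ennreal (C / fact n) * (\<Prod>i = 1..n. \<integral>\<^sup>+x. ennreal (sqrt (a x * b x)) \<partial>\<mu>)" for n
      by (subst P.product_nn_integral_prod[symmetric]) (auto simp: nn_integral_cmult)
    also have "\<dots> n = ennreal (C * (r ^ n / fact n))" for n
      using r C by (simp add: aff1 ennreal_power flip: ennreal_mult)
    finally have "(\<Sum>n. \<integral>\<^sup>+x. ennreal (sqrt (p n x * q n x)) \<partial>(\<Pi>\<^sub>M i\<in>{1..n}. \<mu>))
        = (\<Sum>n. ennreal (C * (r ^ n / fact n)))" by simp
    also have "\<dots> = ennreal (C * exp r)"
      using r exp_converges[of r]
      by (intro suminf_ennreal_eq sums_mult) (auto simp: C divide_inverse mult.commute)
    also have "C * exp r = \<rho>"
      unfolding \<rho>_def hellinger_sq(2)[OF s t, folded ms_def mt_def r_def]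
      by (simp add: C_def field_simps flip: exp_add)
    finally show ?thesis .
  qed

  \<comment> \<open>Among all \<open>c > 0\<close> this one maximizes the resulting bound \<open>(\<rho> - 1 / c) \<cdot> 2 / c\<close> on the error.\<close>
  define c where "c = 2 / \<rho>"
  have c: "0 < c" using \<rho> by (simp add: c_def)
  let ?Ps = "poisson_process M s" and ?Pt = "poisson_process M t" and ?E' = "space (configs M) - E"
  interpret Ps: prob_space ?Ps by (rule prob_space_poisson_process[OF s])
  interpret Pt: prob_space ?Pt by (rule prob_space_poisson_process[OF t])
  have pointwise: "ennreal (sqrt (p n x * q n x))
      \<le> ennreal (c / 2) * (ennreal (p n x) * indicator E (points n x)
            + ennreal (q n x) * indicator ?E' (points n x))
        + ennreal (1 / (2 * c)) * (ennreal (p n x) * 1 + ennreal (q n x) * 1)"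
    if "x \<in> space (\<Pi>\<^sub>M i\<in>{1..n}. \<mu>)" for n x
  proof -
    have "points n x \<in> space (configs M)" using measurable_space[OF pts that] .
    then have "ennreal (c / 2) * (ennreal (p n x) * indicator E (points n x)
            + ennreal (q n x) * indicator ?E' (points n x))
          + ennreal (1 / (2 * c)) * (ennreal (p n x) * 1 + ennreal (q n x) * 1)
        = ennreal (c / 2 * (p n x * of_bool (points n x \<in> E) + q n x * of_bool (points n x \<notin> E))
            + 1 / (2 * c) * (p n x + q n x))"
      using p_nonneg[of n x] q_nonneg[of n x] c
      by (cases "points n x \<in> E") (simp_all del: One_nat_def flip: ennreal_plus ennreal_mult)
    then show ?thesis
      using sqrt_mult_le_testing[OF p_nonneg q_nonneg c] by (simp only: ennreal_leI)
  qed
  have "ennreal \<rho>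
      \<le> (\<Sum>n. \<integral>\<^sup>+x. ennreal (c / 2) * (ennreal (p n x) * indicator E (points n x)
            + ennreal (q n x) * indicator ?E' (points n x))
        + ennreal (1 / (2 * c)) * (ennreal (p n x) * 1 + ennreal (q n x) * 1) \<partial>(\<Pi>\<^sub>M i\<in>{1..n}. \<mu>))"
    unfolding affinity[symmetric]
    by (intro suminf_le nn_integral_mono pointwise) auto
  also have "\<dots> = ennreal (c / 2) * ((\<integral>\<^sup>+X. indicator E X \<partial>?Ps) + (\<integral>\<^sup>+X. indicator ?E' X \<partial>?Pt))
      + ennreal (1 / (2 * c)) * ((\<integral>\<^sup>+X. 1 \<partial>?Ps) + (\<integral>\<^sup>+X. 1 \<partial>?Pt))"
    by (simp add: repr_s repr_t nn_integral_add nn_integral_cmult suminf_add[symmetric]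
        ennreal_suminf_cmult del: One_nat_def nn_integral_indicator nn_integral_const mult_1_right)
  also have "\<dots> = ennreal (c / 2) * (emeasure ?Ps E + emeasure ?Pt ?E') + ennreal (1 / (2 * c)) * 2"
    using E by (simp add: sets_poisson_process Ps.emeasure_space_1 Pt.emeasure_space_1)
  also have "\<dots> = ennreal (1 / \<rho> * (measure ?Ps E + measure ?Pt ?E') + \<rho> / 2)"
    using \<rho>
    by (simp add: Ps.emeasure_eq_measure Pt.emeasure_eq_measure c_def
        flip: ennreal_numeral ennreal_plus ennreal_mult)
  finally have "\<rho> \<le> 1 / \<rho> * (measure ?Ps E + measure ?Pt ?E') + \<rho> / 2"
    using \<rho> by (subst (asm) ennreal_le_iff) auto
  then have "\<rho>\<^sup>2 / 2 \<le> measure ?Ps E + measure ?Pt ?E'"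
    using \<rho> by (simp add: field_simps power2_eq_square)
  moreover have "exp (- 2 * (hellinger M s t)\<^sup>2) = \<rho>\<^sup>2"
    by (simp add: \<rho>_def power2_eq_square flip: exp_add)
  ultimately show ?thesis
    by (simp add: Ps.emeasure_eq_measure Pt.emeasure_eq_measure ennreal_leI flip: ennreal_plus)
qed

section \<open>Averaging over the edges of the cube\<close>

lemma hamming_nonneg [simp]: "0 \<le> hamming D \<delta> \<epsilon>"
  by (simp add: hamming_def sum_nonneg)

lemma finite_cube: "finite (cube D)"
  unfolding cube_def by (intro finite_PiE) auto

lemma cube_nonempty: "cube D \<noteq> {}"
  by (simp add: cube_def PiE_eq_empty_iff)

lemma cube_coord: "\<delta> \<in> cube D \<Longrightarrow> k \<in> {1..D} \<Longrightarrow> \<delta> k = 0 \<or> \<delta> k = 1"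
  by (auto simp: cube_def PiE_iff)

lemma cube_upd: "\<delta> \<in> cube D \<Longrightarrow> k \<in> {1..D} \<Longrightarrow> v = 0 \<or> v = 1 \<Longrightarrow> \<delta>(k := v) \<in> cube D"
  by (auto simp: cube_def PiE_iff extensional_def)

lemma sum_cube_split:
  fixes f :: "(nat \<Rightarrow> int) \<Rightarrow> 'b::comm_monoid_add"
  assumes k: "k \<in> {1..D}"
  shows "(\<Sum>\<delta>\<in>cube D. f \<delta>) = (\<Sum>\<delta> | \<delta> \<in> cube D \<and> \<delta> k = 0. f \<delta> + f (\<delta>(k := 1)))"
proof -
  have "cube D = {\<delta>\<in>cube D. \<delta> k = 0} \<union> {\<delta>\<in>cube D. \<delta> k = 1}"
    using cube_coord[OF _ k] by auto
  then have "(\<Sum>\<delta>\<in>cube D. f \<delta>)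
      = (\<Sum>\<delta> | \<delta> \<in> cube D \<and> \<delta> k = 0. f \<delta>) + (\<Sum>\<delta> | \<delta> \<in> cube D \<and> \<delta> k = 1. f \<delta>)"
    using finite_cube[of D] by (subst sum.union_disjoint[symmetric]) auto
  also have "(\<Sum>\<delta> | \<delta> \<in> cube D \<and> \<delta> k = 1. f \<delta>)
      = (\<Sum>\<delta> | \<delta> \<in> cube D \<and> \<delta> k = 0. f (\<delta>(k := 1)))"
    using cube_upd[OF _ k]
    by (intro sum.reindex_bij_witness[of _ "\<lambda>\<delta>. \<delta>(k := 1)" "\<lambda>\<delta>. \<delta>(k := 0)"])
      (auto simp: fun_upd_idem)
  finally show ?thesis by (simp add: sum.distrib)
qed

text \<open>
  Each edge is determined by its direction and its lower endpoint.
\<close>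

lemma sum_cube_edges:
  fixes g :: "(nat \<Rightarrow> int) \<times> (nat \<Rightarrow> int) \<Rightarrow> 'b::comm_monoid_add"
  shows "(\<Sum>e\<in>cube_edges D. g e)
    = (\<Sum>k = 1..D. \<Sum>\<delta> | \<delta> \<in> cube D \<and> \<delta> k = 0. g (\<delta>, \<delta>(k := 1)))"
proof -
  let ?S = "SIGMA k:{1..D}. {\<delta>\<in>cube D. \<delta> k = 0}"
  let ?h = "\<lambda>(k, \<delta>). (\<delta>, \<delta>(k := 1 :: int))"
  have inj: "inj_on ?h ?S"
  proof (rule inj_onI)
    fix x y assume xy: "x \<in> ?S" "y \<in> ?S" "?h x = ?h y"
    then have snd_eq: "snd x = snd y" by (auto simp: case_prod_unfold)
    moreover have "fst x = fst y"
    proof -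
      have "(snd x)(fst x) = 0" "(snd x)(fst y) = 0" "(snd x)(fst x := 1) = (snd x)(fst y := 1)"
        using xy snd_eq by (auto simp: case_prod_unfold)
      then show ?thesis by (metis fun_upd_apply zero_neq_one)
    qed
    ultimately show "x = y" by (simp add: prod_eq_iff)
  qed
  have img: "cube_edges D = ?h ` ?S"
  proof (intro set_eqI iffI)
    fix e assume "e \<in> cube_edges D"
    then obtain \<delta> \<delta>' k where e: "e = (\<delta>, \<delta>')" "\<delta> \<in> cube D" "\<delta>' \<in> cube D"
      and k: "k \<in> {1..D}" "\<delta> k = 0" "\<delta>' k = 1"
      and rest: "\<forall>j\<in>{1..D}. j \<noteq> k \<longrightarrow> \<delta> j = \<delta>' j"
      unfolding cube_edges_def by auto
    have "\<delta>' = \<delta>(k := 1)"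
    proof
      fix j
      show "\<delta>' j = (\<delta>(k := 1)) j"
        using e k rest by (cases "j \<in> {1..D}") (auto simp: cube_def PiE_iff extensional_def)
    qed
    then have "e = ?h (k, \<delta>)" using e by simp
    then show "e \<in> ?h ` ?S" using e k by blast
  next
    fix e assume "e \<in> ?h ` ?S"
    then show "e \<in> cube_edges D" by (auto simp: cube_edges_def intro!: cube_upd)
  qed
  have "(\<Sum>e\<in>cube_edges D. g e) = (\<Sum>(k, \<delta>)\<in>?S. g (\<delta>, \<delta>(k := 1)))"
    unfolding img by (subst sum.reindex[OF inj]) (simp add: case_prod_unfold)
  then show ?thesis using finite_cube[of D] by (simp add: sum.Sigma)
qed

lemma card_cube_edges: "2 * card (cube_edges D) = D * card (cube D)"
proof -
  have "D * card (cube D) = (\<Sum>k = 1..D. \<Sum>\<delta>\<in>cube D. 1)" by simp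
  also have "\<dots> = (\<Sum>k = 1..D. \<Sum>\<delta> | \<delta> \<in> cube D \<and> \<delta> k = 0. 2)"
    by (rule sum.cong[OF refl], subst sum_cube_split) (simp_all flip: mult_2_right)
  also have "\<dots> = (\<Sum>e\<in>cube_edges D. 2)"
    by (rule sum_cube_edges[symmetric])
  finally show ?thesis by simp
qed

text \<open>
  \<open>R \<delta> k\<close> stands for the risk of the \<open>k\<close>-th coordinate at the vertex \<open>\<delta>\<close>. Every pair of a vertex
  and a coordinate belongs to exactly one edge, so that summing the hypothesis over the edges
  bounds the sum of all risks, and thus the largest one times the number of vertices. This number
  is \<open>2 |C| / D\<close>, which turns the factor \<open>1 / 2\<close> into \<open>D / 4\<close> and the sum into an average.
\<close>

lemma assouad:
  fixes R :: "(nat \<Rightarrow> int) \<Rightarrow> nat \<Rightarrow> ennreal"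
  assumes D: "D \<ge> 1" and w: "\<And>e. 0 \<le> w e"
    and R: "\<And>k \<delta>. k \<in> {1..D} \<Longrightarrow> \<delta> \<in> cube D \<Longrightarrow> \<delta> k = 0 \<Longrightarrow>
      ennreal (w (\<delta>, \<delta>(k := 1)) / 2) \<le> R \<delta> k + R (\<delta>(k := 1)) k"
  shows "ennreal (real D / 4 * (1 / real (card (cube_edges D)) * (\<Sum>e\<in>cube_edges D. w e)))
    \<le> (SUP \<delta>\<in>cube D. \<Sum>k = 1..D. R \<delta> k)"
proof -
  define N where "N = card (cube D)"
  define W where "W = (\<Sum>e\<in>cube_edges D. w e)"
  let ?S = "SUP \<delta>\<in>cube D. \<Sum>k = 1..D. R \<delta> k"
  have N: "0 < N" using finite_cube cube_nonempty by (simp add: N_def card_gt_0_iff)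
  have "ennreal (W / 2) = (\<Sum>e\<in>cube_edges D. ennreal (w e / 2))"
    using w by (simp add: W_def sum_divide_distrib sum_ennreal)
  also have "\<dots> = (\<Sum>k = 1..D. \<Sum>\<delta> | \<delta> \<in> cube D \<and> \<delta> k = 0. ennreal (w (\<delta>, \<delta>(k := 1)) / 2))"
    by (rule sum_cube_edges)
  also have "\<dots> \<le> (\<Sum>k = 1..D. \<Sum>\<delta> | \<delta> \<in> cube D \<and> \<delta> k = 0. R \<delta> k + R (\<delta>(k := 1)) k)"
    by (intro sum_mono R) auto
  also have "\<dots> = (\<Sum>k = 1..D. \<Sum>\<delta>\<in>cube D. R \<delta> k)"
    by (rule sum.cong[OF refl], rule sum_cube_split[symmetric])
  also have "\<dots> = (\<Sum>\<delta>\<in>cube D. \<Sum>k = 1..D. R \<delta> k)" by (rule sum.swap)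
  also have "\<dots> \<le> (\<Sum>\<delta>\<in>cube D. ?S)" by (intro sum_mono SUP_upper)
  also have "\<dots> = ennreal (real N) * ?S" by (simp add: N_def ennreal_of_nat_eq_real_of_nat)
  finally have "ennreal (1 / N) * ennreal (W / 2) \<le> ennreal (1 / N) * (ennreal (real N) * ?S)"
    by (rule mult_left_mono) simp
  also have "\<dots> = ?S" using N by (simp flip: mult.assoc ennreal_mult)
  also have "ennreal (1 / N) * ennreal (W / 2) = ennreal (1 / N * (W / 2))"
    using w by (intro ennreal_mult[symmetric]) (auto simp: W_def sum_nonneg)
  also have "1 / N * (W / 2) = real D / 4 * (1 / real (card (cube_edges D)) * W)"
  proof -
    have "2 * real (card (cube_edges D)) = real D * N"
      using card_cube_edges[of D] unfolding N_def by (metis of_nat_mult of_nat_numeral)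
    then have "real (card (cube_edges D)) = real D * N / 2" by simp
    then show ?thesis using D N by (simp add: field_simps)
  qed
  finally show ?thesis by (simp only: W_def)
qed

text \<open>
  On an edge in direction \<open>k\<close> the two risks of the \<open>k\<close>-th coordinate are the error probabilities
  of the test that rejects \<open>s\<^sub>\<delta>\<close> when the estimated coordinate is \<open>1\<close>.
\<close>

lemma poisson_assouad:
  assumes D: "D \<ge> 1" and s: "\<And>\<delta>. \<delta> \<in> cube D \<Longrightarrow> s \<delta> \<in> L1_nonneg M"
    and dhat [measurable]: "dhat \<in> configs M \<rightarrow>\<^sub>M count_space (cube D)"
  shows "ennreal (real D / 4 * (1 / real (card (cube_edges D)) *
        (\<Sum>(\<delta>, \<delta>')\<in>cube_edges D. exp (- 2 * (hellinger M (s \<delta>) (s \<delta>'))\<^sup>2))))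
    \<le> (SUP \<delta>\<in>cube D. \<integral>\<^sup>+X. ennreal (real_of_int (hamming D (dhat X) \<delta>)) \<partial>poisson_process M (s \<delta>))"
proof -
  have in_cube: "dhat X \<in> cube D" if "X \<in> space (configs M)" for X
    using measurable_space[OF dhat that] by simp
  have [measurable]: "(\<lambda>X. g (dhat X)) \<in> configs M \<rightarrow>\<^sub>M count_space UNIV" for g :: "(nat \<Rightarrow> int) \<Rightarrow> int"
    using dhat by (rule measurable_compose) simp
  have [measurable_cong]: "sets (poisson_process M (s \<delta>)) = sets (configs M)" for \<delta>
    by (rule sets_poisson_process)
  have space_pp: "space (poisson_process M (s \<delta>)) = space (configs M)" for \<delta>
    by (rule sets_eq_imp_space_eq) (rule sets_poisson_process)
  define R where "R \<delta> k = (\<integral>\<^sup>+X. ennreal (real_of_int \<bar>dhat X k - \<delta> k\<bar>) \<partial>poisson_process M (s \<delta>))"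
    for \<delta> and k :: nat
  have sum_R: "(\<integral>\<^sup>+X. ennreal (real_of_int (hamming D (dhat X) \<delta>)) \<partial>poisson_process M (s \<delta>))
      = (\<Sum>k = 1..D. R \<delta> k)" for \<delta>
    unfolding R_def hamming_def by (subst nn_integral_sum[symmetric]) (auto simp: sum_ennreal)
  have edge: "ennreal (exp (- 2 * (hellinger M (s \<delta>) (s (\<delta>(k := 1))))\<^sup>2) / 2)
      \<le> R \<delta> k + R (\<delta>(k := 1)) k"
    if k: "k \<in> {1..D}" and \<delta>: "\<delta> \<in> cube D" "\<delta> k = 0" for k \<delta>
  proof -
    let ?E = "{X\<in>space (configs M). dhat X k = 1}"
    have E [measurable]: "?E \<in> sets (configs M)" by measurable
    have \<delta>': "\<delta>(k := 1) \<in> cube D" using \<delta> k by (intro cube_upd) auto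
    have "R \<delta> k = (\<integral>\<^sup>+X. indicator ?E X \<partial>poisson_process M (s \<delta>))"
      unfolding R_def
    proof (intro nn_integral_cong)
      fix X assume "X \<in> space (poisson_process M (s \<delta>))"
      then have X: "X \<in> space (configs M)" by (simp only: space_pp)
      show "ennreal (real_of_int \<bar>dhat X k - \<delta> k\<bar>) = indicator ?E X"
        using cube_coord[OF in_cube[OF X] k] X \<delta> by (elim disjE) simp_all
    qed
    moreover have "R (\<delta>(k := 1)) k
        = (\<integral>\<^sup>+X. indicator (space (configs M) - ?E) X \<partial>poisson_process M (s (\<delta>(k := 1))))"
      unfolding R_def
    proof (intro nn_integral_cong)
      fix X assume "X \<in> space (poisson_process M (s (\<delta>(k := 1))))"
      then have X: "X \<in> space (configs M)" by (simp only: space_pp)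
      show "ennreal (real_of_int \<bar>dhat X k - (\<delta>(k := 1)) k\<bar>) = indicator (space (configs M) - ?E) X"
        using cube_coord[OF in_cube[OF X] k] X by (elim disjE) simp_all
    qed
    ultimately show ?thesis
      using poisson_testing_error[OF s[OF \<delta>(1)] s[OF \<delta>'] E] by simp
  qed
  show ?thesis
    unfolding sum_R
    by (rule assouad[OF D]) (simp_all only: prod.case edge, simp add: case_prod_unfold)
qed

section \<open>From estimators of the intensity to estimators of the vertex\<close>

text \<open>
  Going through the finite set one element at a time and keeping the better candidate makes each
  step a measurable case distinction, ties included.
\<close>

lemma measurable_minimizer:
  fixes g :: "'b \<Rightarrow> 'a \<Rightarrow> real"
  assumes "finite A" "A \<noteq> {}" "\<And>a. a \<in> A \<Longrightarrow> g a \<in> borel_measurable N"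
  shows "\<exists>h \<in> N \<rightarrow>\<^sub>M count_space A. \<forall>x\<in>space N. \<forall>a\<in>A. g (h x) x \<le> g a x"
  using assms
proof (induction rule: finite_ne_induct)
  case (singleton a)
  show ?case by (intro bexI[of _ "\<lambda>_. a"]) auto
next
  case (insert a F)
  have "\<exists>h \<in> N \<rightarrow>\<^sub>M count_space F. \<forall>x\<in>space N. \<forall>b\<in>F. g (h x) x \<le> g b x"
    by (rule insert.IH) (rule insert.prems, simp)
  then obtain h where h [measurable]: "h \<in> N \<rightarrow>\<^sub>M count_space F"
    and min: "\<forall>x\<in>space N. \<forall>b\<in>F. g (h x) x \<le> g b x" by blast
  have [measurable]: "g a \<in> borel_measurable N" using insert.prems by simp
  have [measurable]: "(\<lambda>x. g (h x) x) \<in> borel_measurable N"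
    by (rule measurable_compose_countable'[where f = g, OF _ h])
      (simp_all add: insert.prems insert.hyps(1) countable_finite)
  have [measurable]: "h \<in> N \<rightarrow>\<^sub>M count_space (insert a F)"
    using measurable_compose[OF h, of "\<lambda>b. b" "count_space (insert a F)"] by auto
  show ?case
  proof (rule bexI)
    let ?h = "\<lambda>x. if g a x \<le> g (h x) x then a else h x"
    show "?h \<in> N \<rightarrow>\<^sub>M count_space (insert a F)" by measurable
    show "\<forall>x\<in>space N. \<forall>b\<in>insert a F. g (?h x) x \<le> g b x"
    proof (intro ballI)
      fix x b assume "x \<in> space N" "b \<in> insert a F"
      then show "g (?h x) x \<le> g b x"
        using bspec[OF min, of x] by (cases "b = a") (auto intro: order_trans)
    qed
  qed
qed

lemma space_ball_algebra: "space (ball_algebra L d) = L"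
  unfolding ball_algebra_def by (rule space_measure_of) auto

lemma measurable_dist_ball_algebra:
  assumes t: "t \<in> L"
  shows "d t \<in> borel_measurable (ball_algebra L d)"
proof (subst borel_measurable_iff_less, intro allI)
  fix r
  have "{u \<in> L. d t u < r} \<in> sets (ball_algebra L d)"
    unfolding ball_algebra_def using t by (intro in_measure_of) auto
  then show "{u \<in> space (ball_algebra L d). d t u < r} \<in> sets (ball_algebra L d)"
    by (simp add: space_ball_algebra)
qed

text \<open>
  If \<open>\<epsilon>\<close> is at least as good an approximation of \<open>v\<close> as \<open>\<delta>\<close>, the triangle inequality through \<open>v\<close>
  gives \<open>d s\<^sub>\<epsilon> s\<^sub>\<delta> \<le> 2 d v s\<^sub>\<delta>\<close>.
\<close>

lemma hamming_le_nearest: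
  assumes d: "L1_metric M L d" and mem: "s \<delta> \<in> L" "s \<epsilon> \<in> L" "v \<in> L"
    and sep: "\<theta> * real_of_int (hamming D \<epsilon> \<delta>) \<le> (d (s \<epsilon>) (s \<delta>))\<^sup>2"
    and near: "d (s \<epsilon>) v \<le> d (s \<delta>) v"
  shows "\<theta> / 4 * real_of_int (hamming D \<epsilon> \<delta>) \<le> (d v (s \<delta>))\<^sup>2"
proof -
  have "d (s \<epsilon>) (s \<delta>) \<le> d (s \<epsilon>) v + d v (s \<delta>)" "d (s \<delta>) v = d v (s \<delta>)" "0 \<le> d (s \<epsilon>) (s \<delta>)"
    using d mem unfolding L1_metric_def by blast+
  then have "(d (s \<epsilon>) (s \<delta>))\<^sup>2 \<le> (2 * d v (s \<delta>))\<^sup>2"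
    using near by (intro power_mono) auto
  then show ?thesis using sep by (simp add: power_mult_distrib)
qed

theorem lemma1:
  fixes M :: "'a measure" and D :: nat and s :: "(nat \<Rightarrow> int) \<Rightarrow> 'a \<Rightarrow> real"
  assumes "D \<ge> 1"
    and "\<forall>\<delta>\<in>cube D. s \<delta> \<in> L1_nonneg M"
  shows "(\<forall>dhat \<in> configs M \<rightarrow>\<^sub>M count_space (cube D).
      (SUP \<delta>\<in>cube D. \<integral>\<^sup>+X. ennreal (real_of_int (hamming D (dhat X) \<delta>)) \<partial>poisson_process M (s \<delta>))
        \<ge> ennreal (real D / 4 * (1 / real (card (cube_edges D)) *
            (\<Sum>(\<delta>, \<delta>')\<in>cube_edges D. exp (- 2 * (hellinger M (s \<delta>) (s \<delta>'))\<^sup>2))))) \<and>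
    (\<forall>L d \<theta>. s ` cube D \<subseteq> L \<longrightarrow> L \<subseteq> L1_nonneg M \<longrightarrow> L1_metric M L d \<longrightarrow> \<theta> > 0 \<longrightarrow>
      (\<forall>\<delta>\<in>cube D. \<forall>\<delta>'\<in>cube D. (d (s \<delta>) (s \<delta>'))\<^sup>2 \<ge> \<theta> * real_of_int (hamming D \<delta> \<delta>')) \<longrightarrow>
      (\<forall>shat \<in> configs M \<rightarrow>\<^sub>M ball_algebra L d.
        (SUP t\<in>s ` cube D. \<integral>\<^sup>+X. ennreal ((d (shat X) t)\<^sup>2) \<partial>poisson_process M t)
          \<ge> ennreal (real D * \<theta> / 16 * (1 / real (card (cube_edges D)) *
              (\<Sum>(\<delta>, \<delta>')\<in>cube_edges D. exp (- 2 * (hellinger M (s \<delta>) (s \<delta>'))\<^sup>2))))))"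
proof (intro conjI ballI allI impI)
  fix dhat assume "dhat \<in> configs M \<rightarrow>\<^sub>M count_space (cube D)"
  then show "ennreal (real D / 4 * (1 / real (card (cube_edges D)) *
        (\<Sum>(\<delta>, \<delta>')\<in>cube_edges D. exp (- 2 * (hellinger M (s \<delta>) (s \<delta>'))\<^sup>2))))
    \<le> (SUP \<delta>\<in>cube D. \<integral>\<^sup>+X. ennreal (real_of_int (hamming D (dhat X) \<delta>)) \<partial>poisson_process M (s \<delta>))"
    using assms by (intro poisson_assouad) auto
next
  fix L d \<theta> shat
  assume sub: "s ` cube D \<subseteq> L" and "L \<subseteq> L1_nonneg M" and d: "L1_metric M L d" and \<theta>: "(0::real) < \<theta>"
    and sep: "\<forall>\<delta>\<in>cube D. \<forall>\<delta>'\<in>cube D. \<theta> * real_of_int (hamming D \<delta> \<delta>') \<le> (d (s \<delta>) (s \<delta>'))\<^sup>2"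
    and shat: "shat \<in> configs M \<rightarrow>\<^sub>M ball_algebra L d"
  define A where "A = 1 / real (card (cube_edges D)) *
    (\<Sum>(\<delta>, \<delta>')\<in>cube_edges D. exp (- 2 * (hellinger M (s \<delta>) (s \<delta>'))\<^sup>2))"
  have "\<exists>h \<in> configs M \<rightarrow>\<^sub>M count_space (cube D). \<forall>X\<in>space (configs M). \<forall>\<delta>\<in>cube D.
      d (s (h X)) (shat X) \<le> d (s \<delta>) (shat X)"
    using sub
    by (intro measurable_minimizer[OF finite_cube cube_nonempty, where g = "\<lambda>\<delta> X. d (s \<delta>) (shat X)"]
        measurable_compose[OF shat] measurable_dist_ball_algebra) auto
  then obtain dhat where dhat [measurable]: "dhat \<in> configs M \<rightarrow>\<^sub>M count_space (cube D)"
    and min: "\<forall>X\<in>space (configs M). \<forall>\<delta>\<in>cube D. d (s (dhat X)) (shat X) \<le> d (s \<delta>) (shat X)"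
    by blast
  have le: "ennreal (\<theta> / 4) * (\<integral>\<^sup>+X. ennreal (real_of_int (hamming D (dhat X) \<delta>)) \<partial>poisson_process M (s \<delta>))
      \<le> (\<integral>\<^sup>+X. ennreal ((d (shat X) (s \<delta>))\<^sup>2) \<partial>poisson_process M (s \<delta>))" if \<delta>: "\<delta> \<in> cube D" for \<delta>
  proof -
    have [measurable]: "(\<lambda>X. real_of_int (hamming D (dhat X) \<delta>)) \<in> borel_measurable (poisson_process M (s \<delta>))"
      unfolding measurable_cong_sets[OF sets_poisson_process refl]
      using dhat by (rule measurable_compose) simp
    have "ennreal (\<theta> / 4) * (\<integral>\<^sup>+X. ennreal (real_of_int (hamming D (dhat X) \<delta>)) \<partial>poisson_process M (s \<delta>))
        = (\<integral>\<^sup>+X. ennreal (\<theta> / 4 * real_of_int (hamming D (dhat X) \<delta>)) \<partial>poisson_process M (s \<delta>))"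
      using \<theta> by (subst nn_integral_cmult[symmetric]) (simp_all flip: ennreal_mult)
    also have "\<dots> \<le> (\<integral>\<^sup>+X. ennreal ((d (shat X) (s \<delta>))\<^sup>2) \<partial>poisson_process M (s \<delta>))"
    proof (intro nn_integral_mono ennreal_leI)
      fix X assume "X \<in> space (poisson_process M (s \<delta>))"
      then have X: "X \<in> space (configs M)"
        using sets_eq_imp_space_eq[OF sets_poisson_process] by blast
      have "dhat X \<in> cube D" using measurable_space[OF dhat X] by simp
      moreover have "shat X \<in> L" using measurable_space[OF shat X] by (simp add: space_ball_algebra)
      ultimately show "\<theta> / 4 * real_of_int (hamming D (dhat X) \<delta>) \<le> (d (shat X) (s \<delta>))\<^sup>2"
        using sub sep \<delta> bspec[OF bspec[OF min X] \<delta>] by (intro hamming_le_nearest[OF d]) auto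
    qed
    finally show ?thesis .
  qed
  have A: "0 \<le> A" unfolding A_def by (intro mult_nonneg_nonneg sum_nonneg) auto
  have "ennreal (real D * \<theta> / 16 * A) = ennreal (\<theta> / 4) * ennreal (real D / 4 * A)"
    using \<theta> A by (subst ennreal_mult[symmetric]) (simp_all add: mult_ac)
  also have "\<dots> \<le> ennreal (\<theta> / 4) *
      (SUP \<delta>\<in>cube D. \<integral>\<^sup>+X. ennreal (real_of_int (hamming D (dhat X) \<delta>)) \<partial>poisson_process M (s \<delta>))"
    unfolding A_def using assms by (intro mult_left_mono poisson_assouad[OF _ _ dhat]) auto
  also have "\<dots> \<le> (SUP \<delta>\<in>cube D. \<integral>\<^sup>+X. ennreal ((d (shat X) (s \<delta>))\<^sup>2) \<partial>poisson_process M (s \<delta>))"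
    unfolding SUP_mult_left_ennreal using le by (intro SUP_mono) blast
  finally show "ennreal (real D * \<theta> / 16 * (1 / real (card (cube_edges D)) *
        (\<Sum>(\<delta>, \<delta>')\<in>cube_edges D. exp (- 2 * (hellinger M (s \<delta>) (s \<delta>'))\<^sup>2))))
      \<le> (SUP t\<in>s ` cube D. \<integral>\<^sup>+X. ennreal ((d (shat X) t)\<^sup>2) \<partial>poisson_process M t)"
    unfolding A_def by (simp only: image_image)
qed

end
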